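(* There exists an absolute constant $c>0$ and $\epsilon_0>0$ such that for every constant $0<\epsilon<\epsilon_0$ the following holds. Let $(G_n)$ be a sequence of $(n,d,\lambda)$-graphs (with $d=d(n)$, $\lambda=\lambda(n)$) satisfying $\lambda=o(d)$, let $p=\frac{1+\epsilon}{d}$, and let $G_p$ be the random subgraph of $G_n$ obtained by including each edge independently with probability $p$. Then with high probability $G_p$ contains a path of length at least $c\epsilon^2 n$.
   Context: An $(n,d,\lambda)$-graph is a $d$-regular graph on $n$ vertices in which every eigenvalue of the adjacency matrix except the largest one has absolute value at most $\lambda$. "With high probability" means with probability tending to $1$ as $n\to\infty$. *)

theory Defs
  imports
    "HOL-Probability.Probability"
    "HOL-Library.Landau_Symbols"
    "Jordan_Normal_Form.Char_Poly"
begin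

text \<open>A graph on \<open>n\<close> vertices has vertex set \<open>{..<n}\<close> and is given by its set of edges,
  each edge being a two-element set of vertices.\<close>

definition simple_graph :: "nat \<Rightarrow> nat set set \<Rightarrow> bool" where
  "simple_graph n E \<longleftrightarrow> (\<forall>e\<in>E. e \<subseteq> {..<n} \<and> card e = 2)"

definition degree_of :: "nat set set \<Rightarrow> nat \<Rightarrow> nat" where
  "degree_of E v = card {e \<in> E. v \<in> e}"

definition regular_graph :: "nat \<Rightarrow> nat \<Rightarrow> nat set set \<Rightarrow> bool" where
  "regular_graph n d E \<longleftrightarrow> simple_graph n E \<and> (\<forall>v<n. degree_of E v = d)"

definition adjacency_matrix :: "nat \<Rightarrow> nat set set \<Rightarrow> real mat" where
  "adjacency_matrix n E = Matrix.mat n n (\<lambda>(i, j). if {i, j} \<in> E then 1 else 0)"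

text \<open>Eigenvalues are counted with multiplicity. The adjacency matrix is real symmetric, so its
  characteristic polynomial splits over the reals and this multiset has size \<open>n\<close>.\<close>

definition adjacency_eigenvalues :: "nat \<Rightarrow> nat set set \<Rightarrow> real multiset" where
  "adjacency_eigenvalues n E = proots (char_poly (adjacency_matrix n E))"

text \<open>Only one copy of the largest eigenvalue is exempted from the bound: if it is a multiple
  eigenvalue (as for a disconnected regular graph), then its other copies are subject to it.\<close>

definition ndl_graph :: "nat \<Rightarrow> nat \<Rightarrow> real \<Rightarrow> nat set set \<Rightarrow> bool" where
  "ndl_graph n d l E \<longleftrightarrow> regular_graph n d E \<and>
     (\<forall>\<mu> \<in># adjacency_eigenvalues n E - {#Max_mset (adjacency_eigenvalues n E)#}. \<bar>\<mu>\<bar> \<le> l)"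

definition random_subgraph :: "nat set set \<Rightarrow> real \<Rightarrow> nat set set pmf" where
  "random_subgraph E p =
     map_pmf (\<lambda>X. {e \<in> E. X e}) (Pi_pmf E False (\<lambda>_. bernoulli_pmf p))"

definition is_path :: "nat \<Rightarrow> nat set set \<Rightarrow> nat list \<Rightarrow> bool" where
  "is_path n E xs \<longleftrightarrow> xs \<noteq> [] \<and> distinct xs \<and> set xs \<subseteq> {..<n} \<and>
     (\<forall>i. Suc i < length xs \<longrightarrow> {xs ! i, xs ! Suc i} \<in> E)"

text \<open>The length of a path is its number of edges.\<close>

definition path_length :: "nat list \<Rightarrow> nat" where
  "path_length xs = length xs - 1"

end

theory Submission
  imports Defs
begin

text \<open>
  Explore the random subgraph by depth-first search, revealing an edge only when the search asks for
  it. At any moment let \<open>S\<close> be the set of finished vertices, \<open>U\<close> the stack, which spans a path, and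
  \<open>T\<close> the untouched vertices. Every edge of the graph between \<open>S\<close> and \<open>T\<close> has been queried, and each
  positive answer moves a vertex from \<open>T\<close> to \<open>U\<close>, so there are at most \<open>|S| + |U|\<close> of them.

  Stop when \<open>|S|\<close> is about \<open>\<epsilon> n / 2\<close>. If \<open>|U|\<close> is still below \<open>\<epsilon>\<^sup>2 n / 32\<close>, the expander mixing lemma
  shows that at least about \<open>d |S| |T| / n\<close> edges were queried, so the number of positive answers falls
  short of \<open>p\<close> times the number of queries by order \<open>\<epsilon>\<^sup>2 n\<close>. This difference is a martingale in the
  number of queries, with variance at most \<open>p |E| = O(n)\<close>, and Chebyshev's inequality applies.

  For the mixing lemma, the Rayleigh quotient on the orthogonal complement of the all-ones vector
  is maximised at an eigenvector there. Its eigenvalue is one of those bounded by \<open>\<lambda>\<close>: should it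
  equal \<open>d\<close>, then the eigenspace of \<open>d\<close> is at least two-dimensional and \<open>d\<close> is a multiple root of
  the characteristic polynomial.
\<close>

subsection \<open>Adaptive edge queries\<close>

text \<open>The first subtree is followed after a positive answer, the second after a negative one.\<close>

datatype 'a query_tree = Stop | Query 'a "'a query_tree" "'a query_tree"

primrec queried :: "'a query_tree \<Rightarrow> 'a set \<Rightarrow> 'a set" where
  "queried Stop H = {}"
| "queried (Query e t u) H = insert e (if e \<in> H then queried t H else queried u H)"

text \<open>Deleting \<open>e\<close> in both subtrees forbids asking for the same edge twice along
  a branch, so each answer is a fresh coin toss.\<close>

primrec queries_within :: "'a query_tree \<Rightarrow> 'a set \<Rightarrow> bool" where
  "queries_within Stop E \<longleftrightarrow> True"
| "queries_within (Query e t u) E \<longleftrightarrow>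
     e \<in> E \<and> queries_within t (E - {e}) \<and> queries_within u (E - {e})"

text \<open>For a tree without repeated queries this is the terminal value of the martingale whose
  increments are \<open>1 - p\<close> after a positive answer and \<open>- p\<close> after a
  negative one.\<close>

definition surplus :: "real \<Rightarrow> 'a query_tree \<Rightarrow> 'a set \<Rightarrow> real" where
  "surplus p t H = real (card (queried t H \<inter> H)) - p * real (card (queried t H))"

lemma queried_subset: "queries_within t E \<Longrightarrow> queried t H \<subseteq> E"
  by (induction t arbitrary: E) (force split: if_splits)+

text \<open>Only answers about edges of \<open>E\<close> can steer the run. This allows an edge
  already asked for to be added to \<open>H\<close> without affecting the subtree below it.\<close>

lemma queried_cong:
  "queries_within t E \<Longrightarrow> H \<inter> E = H' \<inter> E \<Longrightarrow> queried t H = queried t H'"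
proof (induction t arbitrary: E)
  case (Query e t u)
  have "e \<in> H \<longleftrightarrow> e \<in> H'" "H \<inter> (E - {e}) = H' \<inter> (E - {e})"
    using Query.prems by auto
  then show ?case
    using Query.IH[of "E - {e}"] Query.prems by auto
qed simp

lemma surplus_Query_insert:
  assumes "finite E" "queries_within (Query e t u) (insert e E)" "e \<notin> E"
  shows "surplus p (Query e t u) (insert e H) = (1 - p) + surplus p t H"
proof -
  have t: "queries_within t E"
    using assms by simp
  have Q: "queried t (insert e H) = queried t H"
    by (rule queried_cong[OF t]) (use assms in auto)
  have "queried t H \<subseteq> E"
    using queried_subset[OF t] .
  then have "finite (queried t H)" "e \<notin> queried t H"
    using assms finite_subset by auto
  moreover have "insert e (queried t H) \<inter> insert e H = insert e (queried t H \<inter> H)"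
    by auto
  ultimately show ?thesis
    by (simp add: surplus_def Q algebra_simps)
qed

lemma surplus_Query_notin:
  assumes "finite E" "queries_within (Query e t u) (insert e E)" "e \<notin> E" "e \<notin> H"
  shows "surplus p (Query e t u) H = - p + surplus p u H"
proof -
  have u: "queries_within u E"
    using assms by simp
  have "queried u H \<subseteq> E"
    using queried_subset[OF u] .
  then have "finite (queried u H)" "e \<notin> queried u H"
    using assms finite_subset by auto
  moreover have "insert e (queried u H) \<inter> H = queried u H \<inter> H"
    using assms by auto
  ultimately show ?thesis
    using assms by (simp add: surplus_def algebra_simps)
qed

text \<open>Exposing a single edge first mirrors the root of a query tree, so that moments can be
  computed by induction on the tree.\<close>

lemma random_subgraph_insert:
  assumes "finite E" "e \<notin> E"
  shows "random_subgraph (insert e E) p =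
    bind_pmf (bernoulli_pmf p)
      (\<lambda>b. map_pmf (\<lambda>H. if b then insert e H else H) (random_subgraph E p))"
proof -
  have "{f \<in> insert e E. (X(e := b)) f} = (if b then insert e {f \<in> E. X f} else {f \<in> E. X f})"
    for X b using assms by auto
  then show ?thesis
    unfolding random_subgraph_def Pi_pmf_insert'[OF assms]
    by (simp add: map_bind_pmf map_pmf_comp map_pmf_def[symmetric])
qed

lemma set_pmf_random_subgraph: "set_pmf (random_subgraph E p) \<subseteq> Pow E"
  by (auto simp: random_subgraph_def)

lemma finite_set_pmf_random_subgraph: "finite E \<Longrightarrow> finite (set_pmf (random_subgraph E p))"
  using set_pmf_random_subgraph finite_subset by blast

lemma expectation_random_subgraph_insert:
  fixes f :: "nat set set \<Rightarrow> real"
  assumes "finite E" "e \<notin> E" "0 \<le> p" "p \<le> 1"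
  shows "measure_pmf.expectation (random_subgraph (insert e E) p) f =
    p * measure_pmf.expectation (random_subgraph E p) (\<lambda>H. f (insert e H)) +
    (1 - p) * measure_pmf.expectation (random_subgraph E p) f"
  unfolding random_subgraph_insert[OF assms(1,2)]
  by (subst pmf_expectation_bind[where A = UNIV])
     (use assms in \<open>auto simp: UNIV_bool finite_set_pmf_random_subgraph\<close>)

text \<open>Condition on the answer at the root. Its increment has mean zero and variance
  \<open>p * (1 - p)\<close>, and the cross terms vanish because the surplus of either subtree has
  mean zero. The subtrees live on one edge fewer, so each edge of \<open>E\<close> is charged at
  most \<open>p\<close>.\<close>

lemma expectation_surplus_moments:
  assumes "finite E" "queries_within t E" "0 \<le> p" "p \<le> 1"
  shows "measure_pmf.expectation (random_subgraph E p) (surplus p t) = 0 \<and>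
    measure_pmf.expectation (random_subgraph E p) (\<lambda>H. (surplus p t H)\<^sup>2) \<le> p * card E"
  using assms(1,2)
proof (induction t arbitrary: E)
  case Stop
  then show ?case using assms by (simp add: surplus_def[abs_def])
next
  case (Query e t u E')
  define E where "E = E' - {e}"
  have E': "E' = insert e E" and e: "e \<notin> E" and fin: "finite E"
    using Query.prems by (auto simp: E_def)
  let ?R = "random_subgraph E p"
  let ?Ex = "measure_pmf.expectation ?R"
  have int: "integrable ?R f" for f :: "nat set set \<Rightarrow> real"
    by (intro integrable_measure_pmf_finite finite_set_pmf_random_subgraph fin)
  have q: "queries_within (Query e t u) (insert e E)"
    using Query.prems E' by simp
  have IH: "?Ex (surplus p t) = 0" "?Ex (\<lambda>H. (surplus p t H)\<^sup>2) \<le> p * card E"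
       "?Ex (surplus p u) = 0" "?Ex (\<lambda>H. (surplus p u H)\<^sup>2) \<le> p * card E"
    using Query.IH[OF fin] q e by auto
  \<comment> \<open>The free function \<open>g\<close> lets the same identity serve the first moment
    (identity) and the second moment (square).\<close>
  have ins: "?Ex (\<lambda>H. g (surplus p (Query e t u) (insert e H))) =
      ?Ex (\<lambda>H. g ((1 - p) + surplus p t H))" for g :: "real \<Rightarrow> real"
    using surplus_Query_insert[OF fin q e] by simp
  have out: "?Ex (\<lambda>H. g (surplus p (Query e t u) H)) =
      ?Ex (\<lambda>H. g (- p + surplus p u H))" for g :: "real \<Rightarrow> real"
  proof (intro integral_cong_AE AE_pmfI)
    fix H assume "H \<in> set_pmf ?R"
    then have "e \<notin> H" using set_pmf_random_subgraph e by blast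
    then show "g (surplus p (Query e t u) H) = g (- p + surplus p u H)"
      using surplus_Query_notin[OF fin q e] by simp
  qed auto
  have shift: "?Ex (\<lambda>H. a + f H) = a + ?Ex f" for a and f :: "nat set set \<Rightarrow> real"
    by (subst Bochner_Integration.integral_add) (auto intro: int)
  have square: "?Ex (\<lambda>H. (a + f H)\<^sup>2) = a\<^sup>2 + 2 * a * ?Ex f + ?Ex (\<lambda>H. (f H)\<^sup>2)"
    for a and f :: "nat set set \<Rightarrow> real"
    by (simp add: power2_sum int add.assoc)
  have mean: "measure_pmf.expectation (random_subgraph E' p) (surplus p (Query e t u)) = 0"
    unfolding E' expectation_random_subgraph_insert[OF fin e assms(3,4)]
      ins[of "\<lambda>x. x"] out[of "\<lambda>x. x"] shift IH by (simp add: algebra_simps)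
  let ?a = "?Ex (\<lambda>H. (surplus p t H)\<^sup>2)" and ?b = "?Ex (\<lambda>H. (surplus p u H)\<^sup>2)"
  have "measure_pmf.expectation (random_subgraph E' p) (\<lambda>H. (surplus p (Query e t u) H)\<^sup>2)
      = p * ((1 - p)\<^sup>2 + ?a) + (1 - p) * (p\<^sup>2 + ?b)"
    unfolding E' expectation_random_subgraph_insert[OF fin e assms(3,4)]
      ins[of "\<lambda>x. x\<^sup>2"] out[of "\<lambda>x. x\<^sup>2"] square by (simp add: IH)
  also have "\<dots> \<le> p * ((1 - p)\<^sup>2 + p * card E) + (1 - p) * (p\<^sup>2 + p * card E)"
    using IH assms by (intro add_mono mult_left_mono) auto
  also have "\<dots> = p * (1 - p) + p * card E"
    by (simp add: power2_eq_square algebra_simps)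
  \<comment> \<open>The variance \<open>p * (1 - p)\<close> of the root increment is at most
    \<open>p\<close>, the share of the edge \<open>e\<close>.\<close>
  also have "\<dots> \<le> p * card E'"
    using fin e assms(3) by (simp add: E' algebra_simps)
  finally have "measure_pmf.expectation (random_subgraph E' p)
    (\<lambda>H. (surplus p (Query e t u) H)\<^sup>2) \<le> p * card E'" .
  with mean show ?case by simp
qed

text \<open>Chebyshev's inequality: the mean is zero, so the second moment bounds the tail
  directly.\<close>

lemma prob_surplus_le:
  assumes "finite E" "queries_within t E" "0 \<le> p" "p \<le> 1" "a > 0"
  shows "measure_pmf.prob (random_subgraph E p) {H. surplus p t H \<le> - a} \<le> p * card E / a\<^sup>2"
proof -
  let ?R = "random_subgraph E p"
  have "measure_pmf.prob ?R {H. surplus p t H \<le> - a}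
      \<le> measure_pmf.prob ?R {H \<in> space (measure_pmf ?R). \<bar>surplus p t H\<bar> \<ge> a}"
    by (intro measure_pmf.finite_measure_mono) auto
  also have "\<dots> \<le> measure_pmf.expectation ?R (\<lambda>H. (surplus p t H)\<^sup>2) / a\<^sup>2"
    by (intro measure_pmf.second_moment_method)
       (use assms in \<open>auto intro!: integrable_measure_pmf_finite finite_set_pmf_random_subgraph\<close>)
  also have "\<dots> \<le> p * card E / a\<^sup>2"
    using expectation_surplus_moments[OF assms(1-4)] by (intro divide_right_mono) auto
  finally show ?thesis .
qed

subsection \<open>Depth-first search\<close>

definition edges_between :: "nat set set \<Rightarrow> nat set \<Rightarrow> nat set \<Rightarrow> nat set set" where
  "edges_between E S T = {e \<in> E. \<exists>x\<in>S. \<exists>y\<in>T. e = {x, y}}"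

lemma edges_between_insert:
  "edges_between E (insert x S) T = edges_between E {x} T \<union> edges_between E S T"
  by (auto simp: edges_between_def)

lemma edges_between_mono: "T \<subseteq> T' \<Longrightarrow> edges_between E S T \<subseteq> edges_between E S T'"
  by (auto simp: edges_between_def)

text \<open>The tree is chosen before \<open>H\<close>, as the tail bound for the surplus requires;
  only the final state depends on \<open>H\<close>. The last bound holds because a positive answer
  pushes a vertex on the stack, and vertices leave the stack only to enter \<open>S\<close>.\<close>

lemma depth_first_search:
  fixes n s :: nat and E :: "nat set set"
  assumes fin: "finite E" and sn: "s \<le> n"
  obtains t where "queries_within t E"
    "\<And>H. H \<subseteq> E \<Longrightarrow> \<exists>S xs. S \<subseteq> {..<n} \<and> card S = s \<and> distinct xs \<and> set xs \<subseteq> {..<n} - S \<and>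
      successively (\<lambda>x y. {x, y} \<in> H) xs \<and>
      edges_between E S ({..<n} - S - set xs) \<subseteq> queried t H \<and>
      card (queried t H \<inter> H) \<le> s + length xs"
proof -
  define V where "V = {..<n}"
  define final where "final H R S xs \<longleftrightarrow> S \<subseteq> V \<and> card S = s \<and> distinct xs \<and> set xs \<subseteq> V - S \<and>
      successively (\<lambda>x y. {x, y} \<in> H) xs \<and>
      edges_between E S (V - S - set xs) \<subseteq> R \<and> card (R \<inter> H) \<le> s + length xs"
    for H R S xs
  have finV: "finite V" and cardV: "card V = n" by (auto simp: V_def)
  \<comment> \<open>The claim for an arbitrary state in mid-search: \<open>Q\<close> holds the edges
    queried so far, \<open>P\<close> those answered positively, and \<open>H \<inter> Q = P\<close>
    says that \<open>H\<close> agrees with these answers. The head of \<open>xs\<close> is the top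
    of the stack.\<close>
  have main: "\<exists>t. queries_within t (E - Q) \<and>
      (\<forall>H. H \<subseteq> E \<longrightarrow> H \<inter> Q = P \<longrightarrow> (\<exists>S xs. final H (Q \<union> queried t H) S xs))"
    if "S \<subseteq> V" "card S \<le> s" "distinct xs" "set xs \<subseteq> V - S"
       "successively (\<lambda>x y. {x, y} \<in> P) xs" "edges_between E S (V - S - set xs) \<subseteq> Q"
       "Q \<subseteq> E" "P \<subseteq> Q" "card P \<le> card S + length xs"
    for S xs Q P
    using that
  \<comment> \<open>Each kind of step lowers one summand and raises none: a query shrinks
    \<open>E - Q\<close>, finishing a vertex enlarges \<open>S\<close>, starting a new root shrinks
    the untouched set.\<close>
  proof (induction "card (E - Q) + (n - card S) + card (V - S - set xs)"
      arbitrary: S xs Q P rule: less_induct)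
    case less
    note inv = less.prems
    have finS: "finite S" using inv(1) finV finite_subset by blast
    show ?case
    proof (cases "card S = s")
      case True
      have "final H (Q \<union> queried Stop H) S xs" if "H \<inter> Q = P" for H
      proof -
        have "successively (\<lambda>x y. {x, y} \<in> H) xs"
          using inv(5) by (rule successively_mono) (use that in auto)
        then show ?thesis
          using inv True that by (simp add: final_def Int_commute)
      qed
      then show ?thesis
        by (intro exI[of _ Stop]) auto
    next
      case False
      then have lt: "card S < s" using inv by simp
      show ?thesis
      proof (cases xs)
        case Nil
        \<comment> \<open>With an empty stack, an untouched vertex becomes a new root without any
          query.\<close>
        have "S \<noteq> V" using lt sn cardV by auto
        then obtain y where y: "y \<in> V" "y \<notin> S" using inv(1) by auto
        have "card (V - S - set [y]) < card (V - S - set xs)"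
          by (rule psubset_card_mono) (use y finV Nil in auto)
        moreover have "edges_between E S (V - S - set [y]) \<subseteq> Q"
          using inv(6) edges_between_mono[of "V - S - set [y]" "V - S - set xs"] Nil by auto
        ultimately show ?thesis
          using inv y Nil by (intro less.hyps[of Q S "[y]" P]) auto
      next
        case (Cons x ys)
        show ?thesis
        proof (cases "\<exists>y \<in> V - S - set xs. {x, y} \<in> E - Q")
          case True
          \<comment> \<open>Query an edge from the top \<open>x\<close> to an untouched
            \<open>y\<close>. A positive answer pushes \<open>y\<close>; a negative one leaves the
            stack alone and only enlarges \<open>Q\<close>.\<close>
          then obtain y where y: "y \<in> V - S - set xs" and e: "{x, y} \<in> E - Q" by auto
          define e where "e = {x, y}"
          have eE: "e \<in> E" "e \<notin> Q" using e by (auto simp: e_def)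
          have finP: "finite P" using finite_subset[OF inv(8) finite_subset[OF inv(7) fin]] .
          have c1: "card (E - insert e Q) < card (E - Q)"
            by (rule psubset_card_mono) (use eE fin in auto)
          have c2: "card (V - S - set (y # xs)) \<le> card (V - S - set xs)"
            by (rule card_mono) (use finV in auto)
          have "successively (\<lambda>x y. {x, y} \<in> insert e P) xs"
            using inv(5) by (rule successively_mono) auto
          then have suc: "successively (\<lambda>x y. {x, y} \<in> insert e P) (y # xs)"
            by (simp add: Cons e_def insert_commute)
          have eb: "edges_between E S (V - S - set (y # xs)) \<subseteq> insert e Q"
            using inv(6) edges_between_mono[of "V - S - set (y # xs)" "V - S - set xs"] by auto
          have cP: "card (insert e P) \<le> card S + length (y # xs)"
            using inv(9) finP by (simp add: card_insert_if)
          have m1: "card (E - insert e Q) + (n - card S) + card (V - S - set (y # xs))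
              < card (E - Q) + (n - card S) + card (V - S - set xs)"
            using c1 c2 by linarith
          have m2: "card (E - insert e Q) + (n - card S) + card (V - S - set xs)
              < card (E - Q) + (n - card S) + card (V - S - set xs)"
            using c1 by linarith
          have "\<exists>t. queries_within t (E - insert e Q) \<and>
              (\<forall>H. H \<subseteq> E \<longrightarrow> H \<inter> insert e Q = insert e P \<longrightarrow>
                (\<exists>S xs. final H (insert e Q \<union> queried t H) S xs))"
            by (rule less.hyps[OF m1 inv(1,2) _ _ suc eb _ _ cP]) (use inv y eE in auto)
          then obtain t where t: "queries_within t (E - insert e Q)"
            "\<And>H. H \<subseteq> E \<Longrightarrow> H \<inter> insert e Q = insert e P \<Longrightarrow>
               \<exists>S xs. final H (insert e Q \<union> queried t H) S xs"
            by blast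
          have "\<exists>u. queries_within u (E - insert e Q) \<and>
              (\<forall>H. H \<subseteq> E \<longrightarrow> H \<inter> insert e Q = P \<longrightarrow>
                (\<exists>S xs. final H (insert e Q \<union> queried u H) S xs))"
            by (rule less.hyps[OF m2 inv(1-5) _ _ _ inv(9)]) (use inv eE in auto)
          then obtain u where u: "queries_within u (E - insert e Q)"
            "\<And>H. H \<subseteq> E \<Longrightarrow> H \<inter> insert e Q = P \<Longrightarrow>
               \<exists>S xs. final H (insert e Q \<union> queried u H) S xs"
            by blast
          have "queries_within (Query e t u) (E - Q)"
            using t(1) u(1) eE by (simp add: Diff_insert[symmetric])
          moreover have "\<exists>S xs. final H (Q \<union> queried (Query e t u) H) S xs"
            if H: "H \<subseteq> E" "H \<inter> Q = P" for H
          proof (cases "e \<in> H")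
            case True
            then show ?thesis using t(2)[of H] H by auto
          next
            case False
            then show ?thesis using u(2)[of H] H by auto
          qed
          ultimately show ?thesis by blast
        next
          case False
          \<comment> \<open>Nothing is left to ask at \<open>x\<close>, so it moves from the stack
            to \<open>S\<close>. The untouched set and \<open>card S + length xs\<close> stay the
            same.\<close>
          have T: "V - insert x S - set ys = V - S - set xs"
            using Cons by auto
          have xS: "x \<notin> S" "x \<in> V" using inv Cons by auto
          have "edges_between E {x} (V - S - set xs) \<subseteq> Q"
            using False by (auto simp: edges_between_def)
          then have eb: "edges_between E (insert x S) (V - insert x S - set ys) \<subseteq> Q"
            using inv(6) unfolding T edges_between_insert[of E x S] by blast
          have suc: "successively (\<lambda>x y. {x, y} \<in> P) ys"
            using inv(5) Cons by (cases ys) auto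
          have cS: "card (insert x S) = Suc (card S)"
            using xS(1) finS by simp
          have m: "card (E - Q) + (n - card (insert x S)) + card (V - insert x S - set ys)
              < card (E - Q) + (n - card S) + card (V - S - set xs)"
            unfolding T cS using lt sn by linarith
          show ?thesis
            by (rule less.hyps[OF m _ _ _ _ suc eb inv(7,8)]) (use inv xS cS lt Cons in auto)
        qed
      qed
    qed
  qed
  have "\<exists>t. queries_within t (E - {}) \<and>
      (\<forall>H. H \<subseteq> E \<longrightarrow> H \<inter> {} = {} \<longrightarrow> (\<exists>S xs. final H ({} \<union> queried t H) S xs))"
    by (rule main[of "{}" "[]" "{}" "{}"]) (auto simp: edges_between_def)
  then obtain t where "queries_within t E" "\<And>H. H \<subseteq> E \<Longrightarrow> \<exists>S xs. final H (queried t H) S xs"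
    by auto
  then show thesis
    by (intro that[of t]) (auto simp: final_def V_def)
qed

subsection \<open>Rayleigh quotients orthogonal to the all-ones vector\<close>

text \<open>Vectors are functions on all of \<open>nat\<close> of which only the values below
  \<open>n\<close> count; compactness can then be taken from the product topology.\<close>

definition bilinear_form :: "nat \<Rightarrow> (nat \<Rightarrow> nat \<Rightarrow> real) \<Rightarrow> (nat \<Rightarrow> real) \<Rightarrow> (nat \<Rightarrow> real) \<Rightarrow> real"
  where "bilinear_form n b x y = (\<Sum>i<n. \<Sum>j<n. b i j * x i * y j)"

lemma bilinear_form_cong:
  assumes "\<And>i. i < n \<Longrightarrow> x i = x' i" "\<And>i. i < n \<Longrightarrow> y i = y' i"
  shows "bilinear_form n b x y = bilinear_form n b x' y'"
  unfolding bilinear_form_def using assms by (intro sum.cong) auto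

lemma bilinear_form_add_left:
  "bilinear_form n b (\<lambda>i. x i + y i) z = bilinear_form n b x z + bilinear_form n b y z"
  by (simp add: bilinear_form_def sum.distrib algebra_simps)

lemma bilinear_form_add_right:
  "bilinear_form n b z (\<lambda>i. x i + y i) = bilinear_form n b z x + bilinear_form n b z y"
  by (simp add: bilinear_form_def sum.distrib algebra_simps)

lemma bilinear_form_scale_left:
  "bilinear_form n b (\<lambda>i. c * x i) y = c * bilinear_form n b x y"
  by (simp add: bilinear_form_def sum_distrib_left algebra_simps)

lemma bilinear_form_scale_right:
  "bilinear_form n b x (\<lambda>i. c * y i) = c * bilinear_form n b x y"
  by (simp add: bilinear_form_def sum_distrib_left algebra_simps)

lemma bilinear_form_sym:
  assumes "\<And>i j. b i j = b j i"
  shows "bilinear_form n b x y = bilinear_form n b y x"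
  unfolding bilinear_form_def
  by (subst sum.swap, intro sum.cong refl) (simp add: assms[of i j for i j] mult.assoc mult.commute)

lemma bilinear_form_eq: "bilinear_form n b x y = (\<Sum>i<n. x i * (\<Sum>j<n. b i j * y j))"
  by (simp add: bilinear_form_def sum_distrib_left algebra_simps)

text \<open>Tychonoff's theorem. Pinning the coordinates from \<open>n\<close> on to zero makes this
  a copy of an \<open>n\<close>-dimensional cube.\<close>

lemma compact_box_sequences:
  "compact {x :: nat \<Rightarrow> real. \<forall>i. x i \<in> (if i < n then {-1..1} else {0})}"
proof -
  have "compactin (product_topology (\<lambda>_. euclidean) UNIV)
      (PiE UNIV (\<lambda>i. if i < n then {-1..1::real} else {0}))"
    unfolding compactin_PiE by simp
  then have "compact (PiE UNIV (\<lambda>i::nat. if i < n then {-1..1::real} else {0}))"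
    by (simp add: euclidean_product_topology)
  moreover have "PiE UNIV (\<lambda>i::nat. if i < n then {-1..1::real} else {0}) =
      {x. \<forall>i. x i \<in> (if i < n then {-1..1} else {0})}"
    by (simp add: PiE_UNIV_domain Pi_def)
  ultimately show ?thesis by metis
qed

text \<open>The unit vectors of zero sum form a closed subset \<open>K\<close> of a compact cube,
  nonempty thanks to \<open>w\<close>, so the continuous form attains its maximum there. Homogeneity
  extends the bound to all vectors of zero sum.\<close>

lemma rayleigh_quotient_maximizer:
  fixes b :: "nat \<Rightarrow> nat \<Rightarrow> real" and w :: "nat \<Rightarrow> real"
  assumes w: "(\<Sum>i<n. w i) = 0" "k < n" "w k \<noteq> 0"
  obtains v where "(\<Sum>i<n. v i) = 0" "(\<Sum>i<n. (v i)\<^sup>2) = 1"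
    "\<And>x. (\<Sum>i<n. x i) = 0 \<Longrightarrow> bilinear_form n b x x \<le> bilinear_form n b v v * (\<Sum>i<n. (x i)\<^sup>2)"
proof -
  define K where "K = {x :: nat \<Rightarrow> real. \<forall>i. x i \<in> (if i < n then {-1..1} else {0})}
    \<inter> ({x. (\<Sum>i<n. x i) = 0} \<inter> {x. (\<Sum>i<n. (x i)\<^sup>2) = 1})"
  define unit where "unit x i = (if i < n then x i / sqrt (\<Sum>i<n. (x i)\<^sup>2) else 0)"
    for x :: "nat \<Rightarrow> real" and i
  have "compact K"
    unfolding K_def
    by (intro compact_Int_closed compact_box_sequences closed_Int closed_Collect_eq
        continuous_intros continuous_on_product_coordinates)
  have unit: "unit x \<in> K"
      "bilinear_form n b x x = bilinear_form n b (unit x) (unit x) * (\<Sum>i<n. (x i)\<^sup>2)"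
    if x: "(\<Sum>i<n. x i) = 0" "(\<Sum>i<n. (x i)\<^sup>2) \<noteq> 0" for x
  proof -
    define N where "N = (\<Sum>i<n. (x i)\<^sup>2)"
    have N: "N > 0"
      using x(2) sum_nonneg[of "{..<n}" "\<lambda>i. (x i)\<^sup>2"] by (simp add: N_def less_le)
    have u: "unit x i = (if i < n then x i / sqrt N else 0)" for i
      by (simp add: unit_def N_def)
    have "(\<Sum>i<n. unit x i) = (\<Sum>i<n. x i) / sqrt N"
      by (simp add: u sum_divide_distrib)
    moreover have sq: "(\<Sum>i<n. (unit x i)\<^sup>2) = 1"
      using N by (simp add: u power_divide sum_divide_distrib[symmetric] N_def[symmetric])
    moreover have "unit x i \<in> {-1..1}" if "i < n" for i
    proof -
      have "(unit x i)\<^sup>2 \<le> (\<Sum>i<n. (unit x i)\<^sup>2)"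
        by (rule member_le_sum) (use that in auto)
      then have "\<bar>unit x i\<bar> \<le> 1"
        unfolding sq by (simp add: abs_square_le_1)
      then show ?thesis by (auto simp: abs_le_iff)
    qed
    ultimately show "unit x \<in> K"
      using x by (auto simp: K_def u)
    have "bilinear_form n b x x =
        bilinear_form n b (\<lambda>i. sqrt N * unit x i) (\<lambda>i. sqrt N * unit x i)"
      by (rule bilinear_form_cong) (use N in \<open>auto simp: u\<close>)
    also have "\<dots> = bilinear_form n b (unit x) (unit x) * N"
      using N by (simp add: bilinear_form_scale_left bilinear_form_scale_right)
    finally show "bilinear_form n b x x =
        bilinear_form n b (unit x) (unit x) * (\<Sum>i<n. (x i)\<^sup>2)"
      by (simp add: N_def)
  qed
  have "(\<Sum>i<n. (w i)\<^sup>2) \<noteq> 0"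
    using w by (subst sum_nonneg_eq_0_iff) auto
  then have "K \<noteq> {}"
    using unit(1)[OF w(1)] by auto
  moreover have "continuous_on K (\<lambda>x. bilinear_form n b x x)"
    unfolding bilinear_form_def
    by (intro continuous_intros continuous_on_product_coordinates[THEN continuous_on_subset]) auto
  ultimately obtain v where v: "v \<in> K" "\<And>x. x \<in> K \<Longrightarrow> bilinear_form n b x x \<le> bilinear_form n b v v"
    using continuous_attains_sup[OF \<open>compact K\<close>] by blast
  show thesis
  proof (rule that)
    show "(\<Sum>i<n. v i) = 0" "(\<Sum>i<n. (v i)\<^sup>2) = 1"
      using v(1) by (auto simp: K_def)
    fix x :: "nat \<Rightarrow> real"
    assume x: "(\<Sum>i<n. x i) = 0"
    show "bilinear_form n b x x \<le> bilinear_form n b v v * (\<Sum>i<n. (x i)\<^sup>2)"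
    proof (cases "(\<Sum>i<n. (x i)\<^sup>2) = 0")
      case True
      then have "x i = 0" if "i < n" for i
        using that by (subst (asm) sum_nonneg_eq_0_iff) auto
      then have "bilinear_form n b x x = 0"
        by (simp add: bilinear_form_def)
      then show ?thesis using True by simp
    next
      case False
      show ?thesis
        unfolding unit(2)[OF x False]
        by (intro mult_right_mono v(2) unit(1) x False sum_nonneg) auto
    qed
  qed
qed

lemma quadratic_nonpos_imp_linear_coeff_zero:
  fixes a b :: real
  assumes "\<And>t. 2 * t * a + t\<^sup>2 * b \<le> 0"
  shows "a = 0"
proof (rule ccontr)
  assume "a \<noteq> 0"
  \<comment> \<open>At \<open>t = a / B\<close> the linear term outweighs the quadratic one, since
    \<open>B\<close> exceeds \<open>\<bar>b\<bar>\<close>.\<close>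
  define B where "B = \<bar>b\<bar> + 1"
  have B: "B > 0" "2 * B + b > 0" by (auto simp: B_def)
  have "2 * (a / B) * a + (a / B)\<^sup>2 * b = a\<^sup>2 * (2 * B + b) / B\<^sup>2"
    using B by (simp add: field_simps power2_eq_square)
  moreover have "\<dots> > 0"
    using B \<open>a \<noteq> 0\<close> by simp
  ultimately show False
    using assms[of "a / B"] by linarith
qed

text \<open>At the maximiser the first variation vanishes in every direction of zero sum. Symmetry
  and constant row sums give the residual \<open>b v - \<mu> v\<close> zero sum too, so it is
  orthogonal to itself and hence zero.\<close>

lemma rayleigh_quotient_max_eigenvector:
  fixes b :: "nat \<Rightarrow> nat \<Rightarrow> real" and w :: "nat \<Rightarrow> real"
  assumes sym: "\<And>i j. b i j = b j i" and row: "\<And>i. i < n \<Longrightarrow> (\<Sum>j<n. b i j) = r"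
    and w: "(\<Sum>i<n. w i) = 0" "k < n" "w k \<noteq> 0"
  obtains v \<mu> where "(\<Sum>i<n. v i) = 0" "(\<Sum>i<n. (v i)\<^sup>2) = 1"
    "\<And>i. i < n \<Longrightarrow> (\<Sum>j<n. b i j * v j) = \<mu> * v i"
    "\<And>x. (\<Sum>i<n. x i) = 0 \<Longrightarrow> bilinear_form n b x x \<le> \<mu> * (\<Sum>i<n. (x i)\<^sup>2)"
proof -
  obtain v where v: "(\<Sum>i<n. v i) = 0" "(\<Sum>i<n. (v i)\<^sup>2) = 1"
    "\<And>x. (\<Sum>i<n. x i) = 0 \<Longrightarrow> bilinear_form n b x x \<le> bilinear_form n b v v * (\<Sum>i<n. (x i)\<^sup>2)"
    using rayleigh_quotient_maximizer[OF w] by blast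
  define \<mu> where "\<mu> = bilinear_form n b v v"
  have crit: "bilinear_form n b y v = \<mu> * (\<Sum>i<n. y i * v i)" if y: "(\<Sum>i<n. y i) = 0" for y
  proof -
    define \<alpha> where "\<alpha> = bilinear_form n b y v - \<mu> * (\<Sum>i<n. y i * v i)"
    define \<beta> where "\<beta> = bilinear_form n b y y - \<mu> * (\<Sum>i<n. (y i)\<^sup>2)"
    have "2 * t * \<alpha> + t\<^sup>2 * \<beta> \<le> 0" for t
    proof -
      let ?x = "\<lambda>i. v i + t * y i"
      have "(\<Sum>i<n. ?x i) = 0"
        using v(1) y by (simp add: sum.distrib sum_distrib_left[symmetric])
      then have le: "bilinear_form n b ?x ?x \<le> \<mu> * (\<Sum>i<n. (?x i)\<^sup>2)"
        using v(3) by (simp add: \<mu>_def)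
      have "bilinear_form n b ?x ?x = \<mu> + 2 * t * bilinear_form n b y v + t\<^sup>2 * bilinear_form n b y y"
        using bilinear_form_sym[OF sym, where n = n and x = v and y = y]
        by (simp add: bilinear_form_add_left bilinear_form_add_right bilinear_form_scale_left
            bilinear_form_scale_right \<mu>_def power2_eq_square algebra_simps)
      moreover have "(\<Sum>i<n. (?x i)\<^sup>2) = 1 + 2 * t * (\<Sum>i<n. y i * v i) + t\<^sup>2 * (\<Sum>i<n. (y i)\<^sup>2)"
        unfolding v(2)[symmetric]
        by (simp add: power2_sum sum.distrib sum_distrib_left power_mult_distrib algebra_simps)
      ultimately show ?thesis
        using le by (simp add: \<alpha>_def \<beta>_def algebra_simps)
    qed
    then have "\<alpha> = 0" by (rule quadratic_nonpos_imp_linear_coeff_zero)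
    then show ?thesis by (simp add: \<alpha>_def)
  qed
  \<comment> \<open>The residual itself is used as the test direction.\<close>
  define y where "y i = (\<Sum>j<n. b i j * v j) - \<mu> * v i" for i
  have "(\<Sum>i<n. \<Sum>j<n. b i j * v j) = (\<Sum>j<n. (\<Sum>i<n. b j i) * v j)"
    by (subst sum.swap) (simp add: sum_distrib_right sym[of i j for i j])
  also have "\<dots> = r * (\<Sum>j<n. v j)"
    by (simp add: row sum_distrib_left)
  finally have "(\<Sum>i<n. y i) = 0"
    by (simp add: y_def sum_subtractf sum_distrib_left[symmetric] v(1))
  then have "bilinear_form n b y v = \<mu> * (\<Sum>i<n. y i * v i)"
    by (rule crit)
  moreover have "bilinear_form n b y v - \<mu> * (\<Sum>i<n. y i * v i) = (\<Sum>i<n. (y i)\<^sup>2)"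
    by (simp add: bilinear_form_eq sum_distrib_left sum_subtractf[symmetric] y_def
        power2_eq_square algebra_simps)
  ultimately have "(\<Sum>i<n. (y i)\<^sup>2) = 0" by simp
  then have "y i = 0" if "i < n" for i
    using that by (subst (asm) sum_nonneg_eq_0_iff) auto
  then have "(\<Sum>j<n. b i j * v j) = \<mu> * v i" if "i < n" for i
    using that by (simp add: y_def)
  then show thesis
    using that[of v \<mu>] v by (simp add: \<mu>_def)
qed

subsection \<open>Multiple roots of the characteristic polynomial\<close>

text \<open>As \<open>u\<close> vanishes at \<open>i\<close>, dropping column \<open>i\<close> does
  not change the product; \<open>u\<close> without that coordinate is the new eigenvector.\<close>

lemma mat_delete_eigenvalue:
  fixes A :: "'a :: field mat" and u :: "'a Matrix.vec"
  assumes A: "A \<in> carrier_mat n n" and i: "i < n"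
    and u: "u \<in> carrier_vec n" "u \<noteq> 0\<^sub>v n" "A *\<^sub>v u = k \<cdot>\<^sub>v u" "u $ i = 0"
  shows "eigenvalue (mat_delete A i i) k"
proof -
  obtain m where n: "n = Suc m" using i by (cases n) auto
  let ?f = "insert_index i"
  define w where "w = Matrix.vec m (\<lambda>j. u $ ?f j)"
  have img: "?f ` {0..<m} = {0..<n} - {i}"
    using insert_index_image[of i m] i n by simp
  have inj: "inj_on ?f {0..<m}"
    by (rule insert_index_inj_on)
  have D: "mat_delete A i i \<in> carrier_mat m m"
    using mat_delete_carrier[OF A] n by simp
  have "w \<noteq> 0\<^sub>v m"
  proof
    assume w0: "w = 0\<^sub>v m"
    have "u $ j = 0" if j: "j < n" for j
    proof (cases "j = i")
      case False
      then have "j \<in> ?f ` {0..<m}" unfolding img using j by simp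
      then obtain j' where "j' < m" "j = ?f j'" by auto
      moreover from this have "w $ j' = 0" using w0 by simp
      ultimately show ?thesis by (simp add: w_def)
    qed (use u in simp)
    then have "u = 0\<^sub>v n" using u(1) by (intro eq_vecI) auto
    with u(2) show False by simp
  qed
  moreover have "mat_delete A i i *\<^sub>v w = k \<cdot>\<^sub>v w"
  proof (rule eq_vecI)
    fix j assume "j < dim_vec (k \<cdot>\<^sub>v w)"
    then have j: "j < m" by (simp add: w_def)
    then have fj: "?f j < n" by (simp add: n insert_index_def)
    have "(mat_delete A i i *\<^sub>v w) $ j = (\<Sum>l\<in>{0..<m}. mat_delete A i i $$ (j, l) * w $ l)"
      using A n j by (simp add: scalar_prod_def w_def)
    also have "\<dots> = (\<Sum>l\<in>{0..<m}. A $$ (?f j, ?f l) * u $ ?f l)"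
      using mat_delete_index[of A m i i j] A i n j by (intro sum.cong) (auto simp: w_def)
    also have "\<dots> = (\<Sum>l\<in>{0..<n} - {i}. A $$ (?f j, l) * u $ l)"
      unfolding img[symmetric] by (simp add: sum.reindex[OF inj])
    also have "\<dots> = (\<Sum>l\<in>{0..<n}. A $$ (?f j, l) * u $ l)"
      using i u(4) by (intro sum.mono_neutral_left) auto
    also have "\<dots> = (A *\<^sub>v u) $ ?f j"
      using A u(1) fj by (simp add: scalar_prod_def)
    also have "\<dots> = (k \<cdot>\<^sub>v w) $ j"
      using u(1,3) fj j by (simp add: w_def)
    finally show "(mat_delete A i i *\<^sub>v w) $ j = (k \<cdot>\<^sub>v w) $ j" .
  qed (use D in \<open>auto simp: w_def\<close>)
  ultimately show ?thesis
    using D unfolding eigenvalue_def eigenvector_def by (intro exI[of _ w]) (auto simp: w_def)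
qed

text \<open>The derivative of the characteristic polynomial is the sum of the characteristic polynomials of
  the principal submatrices of size \<open>n - 1\<close>; an eigenvector vanishing at \<open>i\<close> survives deletion of \<open>i\<close>.\<close>

lemma order_char_poly_ge_2:
  fixes A :: "'a :: field_char_0 mat"
  assumes A: "A \<in> carrier_mat n n" and k: "eigenvalue A k"
    and u: "\<And>i. i < n \<Longrightarrow> \<exists>u :: 'a Matrix.vec. u \<in> carrier_vec n \<and> u \<noteq> 0\<^sub>v n \<and> A *\<^sub>v u = k \<cdot>\<^sub>v u \<and> u $ i = 0"
  shows "2 \<le> order k (char_poly A)"
proof -
  let ?p = "char_poly A"
  have n: "n > 0" by (rule eigenvalue_imp_nonzero_dim[OF A k])
  have deg: "degree ?p = n" and p0: "?p \<noteq> 0"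
    using degree_monic_char_poly[OF A] by auto
  have "poly (char_poly (mat_delete A i i)) k = 0" if "i < n" for i
    using mat_delete_eigenvalue[OF A that] u[OF that]
      eigenvalue_root_char_poly[OF mat_delete_carrier[OF A]] by blast
  then have "poly (pderiv ?p) k = 0"
    unfolding pderiv_char_poly[OF A] by (simp add: poly_sum)
  \<comment> \<open>Here characteristic zero enters: the derivative is nonzero and the order of the
    root drops by exactly one.\<close>
  moreover have "pderiv ?p \<noteq> 0"
    using deg n by (simp add: pderiv_eq_0_iff)
  ultimately have "order k (pderiv ?p) \<noteq> 0"
    by (simp add: order_root)
  moreover have "order k ?p = Suc (order k (pderiv ?p))"
    using k p0 by (intro order_pderiv) (auto simp: eigenvalue_root_char_poly[OF A])
  ultimately show ?thesis by simp
qed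

subsection \<open>Expander mixing\<close>

definition adjacency :: "nat set set \<Rightarrow> nat \<Rightarrow> nat \<Rightarrow> real" where
  "adjacency E i j = (if {i, j} \<in> E then 1 else 0)"

lemma adjacency_sym: "adjacency E i j = adjacency E j i"
  by (simp add: adjacency_def insert_commute)

lemma adjacency_nonneg: "adjacency E i j \<ge> 0"
  by (simp add: adjacency_def)

lemma finite_simple_graph: "simple_graph n E \<Longrightarrow> finite E"
  by (rule finite_subset[of _ "Pow {..<n}"]) (auto simp: simple_graph_def)

lemma card_edges_le:
  assumes "regular_graph n d E"
  shows "card E \<le> n * d"
proof -
  have sg: "simple_graph n E" using assms by (simp add: regular_graph_def)
  have "E \<subseteq> (\<Union>v<n. {e \<in> E. v \<in> e})"
  proof
    fix e assume e: "e \<in> E"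
    then have "e \<subseteq> {..<n}" "e \<noteq> {}" using sg by (auto simp: simple_graph_def)
    then show "e \<in> (\<Union>v<n. {e \<in> E. v \<in> e})" using e by auto
  qed
  then have "card E \<le> card (\<Union>v<n. {e \<in> E. v \<in> e})"
    by (rule card_mono[rotated]) (use finite_simple_graph[OF sg] in auto)
  also have "\<dots> \<le> (\<Sum>v<n. card {e \<in> E. v \<in> e})"
    by (rule card_UN_le) simp
  also have "\<dots> = n * d"
    using assms by (simp add: regular_graph_def degree_of_def)
  finally show ?thesis .
qed

lemma adjacency_row_sum:
  assumes "regular_graph n d E" "i < n"
  shows "(\<Sum>j<n. adjacency E i j) = d"
proof -
  have sg: "\<And>e. e \<in> E \<Longrightarrow> e \<subseteq> {..<n} \<and> card e = 2"
    using assms by (simp add: regular_graph_def simple_graph_def)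
  have "bij_betw (\<lambda>j. {i, j}) {j \<in> {..<n}. {i, j} \<in> E} {e \<in> E. i \<in> e}"
  proof (rule bij_betw_imageI)
    show "inj_on (\<lambda>j. {i, j}) {j \<in> {..<n}. {i, j} \<in> E}"
      by (auto simp: inj_on_def doubleton_eq_iff)
    show "(\<lambda>j. {i, j}) ` {j \<in> {..<n}. {i, j} \<in> E} = {e \<in> E. i \<in> e}"
    proof (intro equalityI subsetI)
      fix e assume "e \<in> {e \<in> E. i \<in> e}"
      then have e: "e \<in> E" "i \<in> e" by auto
      then obtain j where "e = {i, j}"
        using sg[OF e(1)] by (auto simp: card_2_iff)
      then show "e \<in> (\<lambda>j. {i, j}) ` {j \<in> {..<n}. {i, j} \<in> E}"
        using sg[OF e(1)] e by auto
    qed auto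
  qed
  then have "card {j \<in> {..<n}. {i, j} \<in> E} = d"
    using assms by (simp add: bij_betw_same_card regular_graph_def degree_of_def)
  then show ?thesis
    unfolding adjacency_def by (simp add: sum.If_cases Int_def)
qed

text \<open>From \<open>2 * x i * x j \<le> (x i)\<^sup>2 + (x j)\<^sup>2\<close> and the row sums.
  It shows that no eigenvalue exceeds \<open>d\<close>.\<close>

lemma bilinear_form_adjacency_le:
  assumes "regular_graph n d E"
  shows "bilinear_form n (adjacency E) x x \<le> d * (\<Sum>i<n. (x i)\<^sup>2)"
proof -
  have "bilinear_form n (adjacency E) x x
      \<le> (\<Sum>i<n. \<Sum>j<n. adjacency E i j * ((x i)\<^sup>2 / 2) + adjacency E i j * ((x j)\<^sup>2 / 2))"
    unfolding bilinear_form_def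
  proof (intro sum_mono)
    fix i j
    have "x i * x j \<le> (x i)\<^sup>2 / 2 + (x j)\<^sup>2 / 2"
      using sum_squares_bound[of "x i" "x j"] by simp
    then have "adjacency E i j * (x i * x j) \<le> adjacency E i j * ((x i)\<^sup>2 / 2 + (x j)\<^sup>2 / 2)"
      by (rule mult_left_mono) (rule adjacency_nonneg)
    then show "adjacency E i j * x i * x j
        \<le> adjacency E i j * ((x i)\<^sup>2 / 2) + adjacency E i j * ((x j)\<^sup>2 / 2)"
      by (simp only: mult.assoc distrib_left)
  qed
  also have "\<dots> = (\<Sum>i<n. \<Sum>j<n. adjacency E i j * ((x i)\<^sup>2 / 2)) +
      (\<Sum>i<n. \<Sum>j<n. adjacency E i j * ((x j)\<^sup>2 / 2))"
    by (simp only: sum.distrib)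
  also have "(\<Sum>i<n. \<Sum>j<n. adjacency E i j * ((x j)\<^sup>2 / 2)) =
      (\<Sum>i<n. \<Sum>j<n. adjacency E i j * ((x i)\<^sup>2 / 2))"
    by (subst sum.swap) (simp only: adjacency_sym)
  also have "(\<Sum>i<n. \<Sum>j<n. adjacency E i j * ((x i)\<^sup>2 / 2)) = (\<Sum>i<n. d * ((x i)\<^sup>2 / 2))"
    using adjacency_row_sum[OF assms]
    by (intro sum.cong refl) (simp only: sum_distrib_right[symmetric] lessThan_iff)
  finally show ?thesis
    by (simp add: sum_distrib_left[symmetric] sum_divide_distrib[symmetric])
qed

lemma adjacency_matrix_mult_vec:
  "adjacency_matrix n E *\<^sub>v Matrix.vec n f = Matrix.vec n (\<lambda>i. \<Sum>j<n. adjacency E i j * f j)"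
  by (rule eq_vecI)
     (auto simp: adjacency_matrix_def adjacency_def scalar_prod_def lessThan_atLeast0 intro!: sum.cong)

lemma adjacency_matrix_carrier: "adjacency_matrix n E \<in> carrier_mat n n"
  by (simp add: adjacency_matrix_def)

lemma adjacency_eigenvectorI:
  assumes "\<And>i. i < n \<Longrightarrow> (\<Sum>j<n. adjacency E i j * f j) = \<theta> * f i" "k < n" "f k \<noteq> 0"
  shows "Matrix.vec n f \<in> carrier_vec n \<and> Matrix.vec n f \<noteq> 0\<^sub>v n \<and>
    adjacency_matrix n E *\<^sub>v Matrix.vec n f = \<theta> \<cdot>\<^sub>v Matrix.vec n f"
proof -
  have "Matrix.vec n f \<noteq> 0\<^sub>v n"
    using assms(2,3) by (metis index_vec index_zero_vec(1))
  moreover have "adjacency_matrix n E *\<^sub>v Matrix.vec n f = \<theta> \<cdot>\<^sub>v Matrix.vec n f"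
    unfolding adjacency_matrix_mult_vec by (rule eq_vecI) (use assms(1) in auto)
  ultimately show ?thesis by simp
qed

text \<open>The bound could fail only if \<open>\<theta>\<close> were the exempted maximum. Then
  \<open>\<theta> = d\<close>, and subtracting multiples of the all-ones vector from
  \<open>v\<close> gives eigenvectors vanishing at any prescribed vertex, so \<open>\<theta>\<close>
  is a multiple root and a copy of it remains.\<close>

lemma eigenvalue_orthogonal_ones_le:
  assumes G: "ndl_graph n d l E"
    and v: "(\<Sum>i<n. v i) = 0" "k < n" "v k \<noteq> 0"
      "\<And>i. i < n \<Longrightarrow> (\<Sum>j<n. adjacency E i j * v j) = \<theta> * v i"
  shows "\<bar>\<theta>\<bar> \<le> l"
proof -
  let ?A = "adjacency_matrix n E"
  let ?p = "char_poly ?A"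
  let ?M = "adjacency_eigenvalues n E"
  note A = adjacency_matrix_carrier[of n E]
  have reg: "regular_graph n d E" using G by (simp add: ndl_graph_def)
  have p0: "?p \<noteq> 0" using degree_monic_char_poly[OF A] by auto
  have ev: "eigenvalue ?A \<theta>'" if "\<And>i. i < n \<Longrightarrow> (\<Sum>j<n. adjacency E i j * f j) = \<theta>' * f i" "f k \<noteq> 0"
    for f \<theta>'
    using adjacency_eigenvectorI[OF that(1) v(2) that(2)] A
    unfolding eigenvalue_def eigenvector_def by (intro exI[of _ "Matrix.vec n f"]) auto
  have mem: "\<theta>' \<in># ?M \<longleftrightarrow> eigenvalue ?A \<theta>'" for \<theta>'
    using p0 by (simp add: adjacency_eigenvalues_def eigenvalue_root_char_poly[OF A])
  have \<theta>: "\<theta> \<in># ?M" using ev[OF v(4,3)] mem by simp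
  have d: "real d \<in># ?M"
    using ev[of "\<lambda>_. 1" "real d"] mem adjacency_row_sum[OF reg] by simp
  have "\<theta> \<in># ?M - {#Max_mset ?M#}"
  proof (cases "\<theta> = Max_mset ?M")
    case False
    then show ?thesis using \<theta> by (simp add: in_diff_count)
  next
    case True
    have pos: "(\<Sum>i<n. (v i)\<^sup>2) > 0"
      by (rule sum_pos2[of _ k]) (use v in auto)
    have "bilinear_form n (adjacency E) v v = \<theta> * (\<Sum>i<n. (v i)\<^sup>2)"
      unfolding bilinear_form_eq using v(4)
      by (simp add: sum_distrib_left power2_eq_square algebra_simps)
    then have "\<theta> \<le> d"
      using bilinear_form_adjacency_le[OF reg, of v] pos by simp
    moreover have "real d \<le> \<theta>"
      using d unfolding True by simp
    ultimately have \<theta>d: "\<theta> = d" by simp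
    have "2 \<le> order \<theta> ?p"
    proof (rule order_char_poly_ge_2[OF A ev[OF v(4,3)]])
      fix i assume i: "i < n"
      \<comment> \<open>A constant vector of zero sum would be zero, against
        \<open>v k \<noteq> 0\<close>.\<close>
      obtain m where m: "m < n" "v m \<noteq> v i"
      proof (rule ccontr)
        assume "\<not> thesis"
        then have const: "\<And>m. m < n \<Longrightarrow> v m = v i" using that by auto
        then have "(\<Sum>j<n. v j) = n * v i" by simp
        then show False using v i const[of k] by simp
      qed
      let ?f = "\<lambda>j. v j - v i"
      have "(\<Sum>j<n. adjacency E a j * ?f j) = \<theta> * ?f a" if "a < n" for a
        using v(4)[OF that] adjacency_row_sum[OF reg that]
        by (simp add: right_diff_distrib sum_subtractf sum_distrib_right[symmetric] \<theta>d)
      from adjacency_eigenvectorI[OF this m(1)] m(2)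
      show "\<exists>u :: real Matrix.vec. u \<in> carrier_vec n \<and> u \<noteq> 0\<^sub>v n \<and> ?A *\<^sub>v u = \<theta> \<cdot>\<^sub>v u \<and> u $ i = 0"
        using i by (intro exI[of _ "Matrix.vec n ?f"]) auto
    qed
    then have "count ?M \<theta> \<ge> 2"
      using p0 by (simp add: adjacency_eigenvalues_def)
    then show ?thesis
      using \<theta> by (simp add: in_diff_count)
  qed
  then show ?thesis
    using G by (simp add: ndl_graph_def)
qed

text \<open>The Rayleigh maximum is taken for the matrix and for its negative, with
  \<open>\<sigma>\<close> as the sign; an eigenvalue \<open>\<mu>\<close> of the signed matrix is an
  eigenvalue \<open>\<sigma> * \<mu>\<close> of the adjacency matrix.\<close>

lemma abs_bilinear_form_adjacency_le:
  assumes G: "ndl_graph n d l E" and x: "(\<Sum>i<n. x i) = 0"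
  shows "\<bar>bilinear_form n (adjacency E) x x\<bar> \<le> l * (\<Sum>i<n. (x i)\<^sup>2)"
proof (cases "\<exists>k<n. x k \<noteq> 0")
  case False
  then show ?thesis by (simp add: bilinear_form_def)
next
  case True
  then obtain k where k: "k < n" "x k \<noteq> 0" by auto
  have reg: "regular_graph n d E" using G by (simp add: ndl_graph_def)
  have "\<sigma> * bilinear_form n (adjacency E) x x \<le> l * (\<Sum>i<n. (x i)\<^sup>2)" if \<sigma>: "\<bar>\<sigma>\<bar> = 1" for \<sigma>
  proof -
    let ?b = "\<lambda>i j. \<sigma> * adjacency E i j"
    have b: "?b i j = ?b j i" for i j by (simp only: adjacency_sym)
    have row: "(\<Sum>j<n. ?b i j) = \<sigma> * d" if "i < n" for i
      using adjacency_row_sum[OF reg that] by (simp add: sum_distrib_left[symmetric])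
    obtain v \<mu> where v: "(\<Sum>i<n. v i) = 0" "(\<Sum>i<n. (v i)\<^sup>2) = 1"
      "\<And>i. i < n \<Longrightarrow> (\<Sum>j<n. ?b i j * v j) = \<mu> * v i"
      "\<And>x. (\<Sum>i<n. x i) = 0 \<Longrightarrow> bilinear_form n ?b x x \<le> \<mu> * (\<Sum>i<n. (x i)\<^sup>2)"
      using rayleigh_quotient_max_eigenvector[OF b row x k] by blast
    have \<sigma>\<sigma>: "\<sigma> * \<sigma> = 1" using \<sigma> by (simp add: abs_if split: if_splits)
    obtain m where m: "m < n" "v m \<noteq> 0"
    proof (rule ccontr)
      assume "\<not> thesis"
      then have "\<And>m. m < n \<Longrightarrow> v m = 0" using that by auto
      then show False using v(2) by simp
    qed
    have "(\<Sum>j<n. adjacency E i j * v j) = (\<sigma> * \<mu>) * v i" if "i < n" for i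
    proof -
      have "\<sigma> * (\<sigma> * (\<Sum>j<n. adjacency E i j * v j)) = \<sigma> * (\<mu> * v i)"
        using v(3)[OF that] by (simp add: sum_distrib_left mult.assoc)
      then show ?thesis using \<sigma>\<sigma> by (simp add: mult.assoc[symmetric])
    qed
    then have "\<bar>\<sigma> * \<mu>\<bar> \<le> l"
      by (rule eigenvalue_orthogonal_ones_le[OF G v(1) m])
    then have "\<mu> \<le> l"
      using \<sigma> by (simp add: abs_mult)
    have "\<sigma> * bilinear_form n (adjacency E) x x = bilinear_form n ?b x x"
      by (simp add: bilinear_form_def sum_distrib_left mult.assoc)
    also have "\<dots> \<le> \<mu> * (\<Sum>i<n. (x i)\<^sup>2)" by (rule v(4)[OF x])
    also have "\<dots> \<le> l * (\<Sum>i<n. (x i)\<^sup>2)"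
      by (intro mult_right_mono \<open>\<mu> \<le> l\<close> sum_nonneg) auto
    finally show ?thesis .
  qed
  from this[of 1] this[of "-1"] show ?thesis by simp
qed

text \<open>Test with the difference of the indicators of the two ends of \<open>e\<close>: the form
  is -2 and the squared norm 2. Together with \<open>l\<close> small against \<open>d\<close> this
  will force \<open>d \<ge> 2\<close>, so that \<open>(1 + \<epsilon>) / d\<close> is a
  probability.\<close>

lemma ndl_graph_one_le:
  assumes G: "ndl_graph n d l E" and e: "e \<in> E"
  shows "1 \<le> l"
proof -
  have "e \<subseteq> {..<n}" "card e = 2"
    using assms by (auto simp: ndl_graph_def regular_graph_def simple_graph_def)
  then obtain u v where uv: "e = {u, v}" "u \<noteq> v" "u < n" "v < n"
    by (auto simp: card_2_iff)
  have loop: "{i, i} \<notin> E" for i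
    using G by (auto simp: ndl_graph_def regular_graph_def simple_graph_def)
  let ?x = "\<lambda>i. of_bool (i = u) - of_bool (i = v) :: real"
  have sel: "(\<Sum>i<n. f i * of_bool (i = w)) = f w" if "w < n" for f :: "nat \<Rightarrow> real" and w
    using that by (subst sum.cong[OF refl, of _ _ "\<lambda>i. if i = w then f w else 0"]) auto
  have "(\<Sum>i<n. ?x i) = 0"
    using sel[of u "\<lambda>_. 1"] sel[of v "\<lambda>_. 1"] uv by (simp add: sum_subtractf)
  moreover have "(\<Sum>i<n. (?x i)\<^sup>2) = (\<Sum>i<n. 1 * of_bool (i = u) + 1 * of_bool (i = v))"
    using uv by (intro sum.cong) auto
  then have "(\<Sum>i<n. (?x i)\<^sup>2) = 2"
    unfolding sum.distrib using sel[of u "\<lambda>_. 1"] sel[of v "\<lambda>_. 1"] uv by simp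
  moreover have "bilinear_form n (adjacency E) ?x ?x = -2"
  proof -
    have inner: "(\<Sum>j<n. adjacency E i j * ?x j) = adjacency E i u - adjacency E i v" for i
      using sel[of u "adjacency E i"] sel[of v "adjacency E i"] uv
      by (simp only: right_diff_distrib sum_subtractf)
    have "bilinear_form n (adjacency E) ?x ?x =
        (\<Sum>i<n. (adjacency E i u - adjacency E i v) * ?x i)"
      unfolding bilinear_form_eq inner by (simp add: mult.commute)
    also have "\<dots> = (adjacency E u u - adjacency E u v) - (adjacency E v u - adjacency E v v)"
      using sel[of u "\<lambda>i. adjacency E i u - adjacency E i v"]
        sel[of v "\<lambda>i. adjacency E i u - adjacency E i v"] uv
      by (simp only: right_diff_distrib sum_subtractf)
    also have "\<dots> = -2"
      using e uv loop by (simp add: adjacency_def insert_commute)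
    finally show ?thesis .
  qed
  ultimately show ?thesis
    using abs_bilinear_form_adjacency_le[OF G, of ?x] by simp
qed

lemma card_edges_between:
  assumes "finite S" "finite T" "S \<inter> T = {}"
  shows "real (card (edges_between E S T)) = (\<Sum>i\<in>S. \<Sum>j\<in>T. adjacency E i j)"
proof -
  let ?P = "{(i, j) \<in> S \<times> T. {i, j} \<in> E}"
  have "inj_on (\<lambda>(i, j). {i, j}) ?P"
    using assms(3) by (auto simp: inj_on_def doubleton_eq_iff)
  moreover have "(\<lambda>(i, j). {i, j}) ` ?P = edges_between E S T"
    by (auto simp: edges_between_def image_def)
  ultimately have "card (edges_between E S T) = card ?P"
    using card_image by fastforce
  also have "real (card ?P) = (\<Sum>(i, j)\<in>S \<times> T. adjacency E i j)"
  proof -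
    have "(\<Sum>(i, j)\<in>S \<times> T. adjacency E i j) = (\<Sum>z\<in>S \<times> T. if {fst z, snd z} \<in> E then 1 else 0)"
      by (intro sum.cong) (auto simp: adjacency_def)
    also have "\<dots> = real (card (S \<times> T \<inter> {z. {fst z, snd z} \<in> E}))"
      using assms by (simp add: sum.If_cases)
    also have "S \<times> T \<inter> {z. {fst z, snd z} \<in> E} = ?P" by auto
    finally show ?thesis by simp
  qed
  also have "\<dots> = (\<Sum>i\<in>S. \<Sum>j\<in>T. adjacency E i j)"
    by (rule sum.cartesian_product[symmetric])
  finally show ?thesis .
qed

text \<open>The error \<open>l * n / 2\<close> is cruder than the usual one with the square root of
  \<open>card S * card T\<close>, but suffices for \<open>S\<close> and \<open>T\<close> of linear
  size and follows from the quadratic form by polarisation.\<close>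

lemma expander_mixing_lower_bound:
  assumes G: "ndl_graph n d l E" and l: "0 \<le> l"
    and ST: "S \<subseteq> {..<n}" "T \<subseteq> {..<n}" "S \<inter> T = {}"
  shows "d * real (card S) * real (card T) / n - l * n / 2 \<le> card (edges_between E S T)"
proof (cases "n = 0")
  case False
  have reg: "regular_graph n d E" using G by (simp add: ndl_graph_def)
  have fin: "finite S" "finite T" using ST by (auto intro: finite_subset)
  let ?B = "bilinear_form n (adjacency E)"
  \<comment> \<open>The indicator of \<open>A\<close> projected orthogonally to the all-ones
    vector.\<close>
  define x where "x A i = of_bool (i \<in> A) - real (card A) / n" for A :: "nat set" and i :: nat
  have ind: "(\<Sum>i<n. of_bool (i \<in> A) :: real) = card A" if "A \<subseteq> {..<n}" for A
    using that by (simp add: of_bool_def sum.If_cases Int_absorb1)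
  have x0: "(\<Sum>i<n. x A i) = 0" if "A \<subseteq> {..<n}" for A
    using False ind[OF that] by (simp add: x_def sum_subtractf)
  have x2: "(\<Sum>i<n. (x A i)\<^sup>2) \<le> card A" if "A \<subseteq> {..<n}" for A
  proof -
    \<comment> \<open>The square is rewritten linearly in the indicator and \<open>x A\<close>,
      whose sums are known.\<close>
    have "(\<Sum>i<n. (x A i)\<^sup>2) = (\<Sum>i<n. of_bool (i \<in> A) - card A / n * (of_bool (i \<in> A) + x A i))"
      by (intro sum.cong) (auto simp: x_def power2_eq_square algebra_simps)
    also have "\<dots> = card A - card A / n * card A"
      unfolding sum_subtractf sum_distrib_left[symmetric] sum.distrib ind[OF that] x0[OF that]
      by simp
    also have "\<dots> \<le> card A" by simp
    finally show ?thesis .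
  qed
  have ones: "?B z (\<lambda>_. c) = c * d * (\<Sum>i<n. z i)" for z c
    unfolding bilinear_form_eq using adjacency_row_sum[OF reg]
    by (simp add: sum_distrib_right[symmetric] sum_distrib_left[symmetric] mult.commute)
  have ones': "?B (\<lambda>_. c) z = c * d * (\<Sum>i<n. z i)" for z c
    by (rule trans[OF bilinear_form_sym[OF adjacency_sym] ones])
  have "real (card (edges_between E S T)) = (\<Sum>i\<in>S. \<Sum>j\<in>T. adjacency E i j)"
    by (rule card_edges_between[OF fin ST(3)])
  also have "\<dots> = ?B (\<lambda>i. of_bool (i \<in> S)) (\<lambda>j. of_bool (j \<in> T))"
  proof -
    have "(\<Sum>j\<in>T. adjacency E i j) = (\<Sum>j<n. adjacency E i j * of_bool (j \<in> T))" for i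
      using ST by (intro sum.mono_neutral_cong_left) auto
    moreover have "(\<Sum>i\<in>S. f i) = (\<Sum>i<n. of_bool (i \<in> S) * f i)" for f :: "nat \<Rightarrow> real"
      using ST by (intro sum.mono_neutral_cong_left) auto
    ultimately show ?thesis by (simp only: bilinear_form_eq)
  qed
  also have "\<dots> = ?B (\<lambda>i. x S i + card S / n) (\<lambda>i. x T i + card T / n)"
    by (simp add: x_def)
  also have "\<dots> = ?B (x S) (x T) + card S / n * (card T / n * (d * n))"
    unfolding bilinear_form_add_left bilinear_form_add_right ones ones'
    using x0 ST by simp
  also have "card S / n * (card T / n * (d * n)) = d * real (card S) * real (card T) / n"
    using False by simp
  finally have e: "real (card (edges_between E S T)) =
      ?B (x S) (x T) + d * real (card S) * real (card T) / n" .
  \<comment> \<open>Polarisation: the forms at the sum and at the difference differ by four times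
    the mixed term, and their squared norms add up by the parallelogram law.\<close>
  define y where "y = (\<lambda>i. x S i + x T i)"
  define z where "z = (\<lambda>i. x S i + (- 1) * x T i)"
  have "(\<Sum>i<n. y i) = 0" "(\<Sum>i<n. z i) = 0"
    using x0 ST by (simp_all add: y_def z_def sum.distrib sum_subtractf)
  then have yz: "\<bar>?B y y\<bar> \<le> l * (\<Sum>i<n. (y i)\<^sup>2)" "\<bar>?B z z\<bar> \<le> l * (\<Sum>i<n. (z i)\<^sup>2)"
    using abs_bilinear_form_adjacency_le[OF G] by auto
  have "4 * ?B (x S) (x T) = ?B y y - ?B z z"
    using bilinear_form_sym[of "adjacency E" n "x T" "x S", OF adjacency_sym]
    unfolding y_def z_def bilinear_form_add_left bilinear_form_add_right
      bilinear_form_scale_left bilinear_form_scale_right by simp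
  also have "\<dots> \<ge> - (l * ((\<Sum>i<n. (y i)\<^sup>2) + (\<Sum>i<n. (z i)\<^sup>2)))"
    using yz by (simp add: distrib_left)
  also have "(\<Sum>i<n. (y i)\<^sup>2) + (\<Sum>i<n. (z i)\<^sup>2) = 2 * ((\<Sum>i<n. (x S i)\<^sup>2) + (\<Sum>i<n. (x T i)\<^sup>2))"
    unfolding y_def z_def sum.distrib[symmetric] sum_distrib_left
    by (intro sum.cong) (auto simp: power2_eq_square algebra_simps)
  finally have B: "- (l * ((\<Sum>i<n. (x S i)\<^sup>2) + (\<Sum>i<n. (x T i)\<^sup>2))) \<le> 2 * ?B (x S) (x T)"
    by (simp add: distrib_left)
  have "card S + card T \<le> n"
    using card_Un_disjoint[OF fin ST(3)] card_mono[of "{..<n}" "S \<union> T"] ST by simp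
  then have "(\<Sum>i<n. (x S i)\<^sup>2) + (\<Sum>i<n. (x T i)\<^sup>2) \<le> n"
    using x2[OF ST(1)] x2[OF ST(2)] by linarith
  then have "l * ((\<Sum>i<n. (x S i)\<^sup>2) + (\<Sum>i<n. (x T i)\<^sup>2)) \<le> l * n"
    using l by (rule mult_left_mono)
  then show ?thesis
    using e B by simp
qed simp

subsection \<open>Long paths\<close>

text \<open>\<open>N\<close>, \<open>D\<close>, \<open>s\<close>, \<open>u\<close>, \<open>Q\<close>
  stand for the number of vertices, the degree, the sizes of \<open>S\<close> and of the stack, and
  the number of queries. In units of \<open>\<epsilon>\<^sup>2 * N\<close>, the gain
  \<open>s * \<epsilon>\<close> is at least 0.49; the losses are at most 0.278 from
  \<open>s * (s + u) / N\<close>, 3/64 from \<open>u\<close> and 0.0275 from the mixing error. More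
  than 1/20 remains.\<close>

lemma surplus_deficit_estimate:
  fixes \<epsilon> N s u Q D l :: real
  assumes \<epsilon>: "0 < \<epsilon>" "\<epsilon> < 1/10" and N: "64 \<le> \<epsilon>\<^sup>2 * N" "0 < N"
    and s: "0 \<le> s" "s \<le> \<epsilon> * N / 2" "\<epsilon> * N / 2 - 1 \<le> s"
    and u: "0 \<le> u" "u \<le> \<epsilon>\<^sup>2 * N / 32 + 1"
    and D: "0 < D" and l: "l \<le> \<epsilon>\<^sup>2 / 20 * D"
    and Q: "D * s * (N - s - u) / N - l * N / 2 \<le> Q"
  shows "s + u - (1 + \<epsilon>) / D * Q \<le> - (\<epsilon>\<^sup>2 * N / 20)"
proof -
  have e2N: "\<epsilon>\<^sup>2 * N \<le> (1/10) * (\<epsilon> * N)"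
    unfolding power2_eq_square mult.assoc using \<epsilon> N by (intro mult_right_mono) auto
  then have eN: "640 \<le> \<epsilon> * N" using N by linarith
  have u': "u \<le> 3/64 * (\<epsilon>\<^sup>2 * N)" using u N by linarith
  have su: "s + u \<le> 101/200 * (\<epsilon> * N)" using e2N u' s by linarith
  have "(1 + \<epsilon>) / D * (D * s * (N - s - u) / N - \<epsilon>\<^sup>2 / 20 * D * N / 2) \<le> (1 + \<epsilon>) / D * Q"
  proof (intro mult_left_mono)
    have "l * N \<le> \<epsilon>\<^sup>2 / 20 * D * N" using l N by (intro mult_right_mono) auto
    then show "D * s * (N - s - u) / N - \<epsilon>\<^sup>2 / 20 * D * N / 2 \<le> Q" using Q by linarith
  qed (use \<epsilon> D in auto)
  moreover have "(1 + \<epsilon>) / D * (D * s * (N - s - u) / N - \<epsilon>\<^sup>2 / 20 * D * N / 2) =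
      (1 + \<epsilon>) * s - (1 + \<epsilon>) * (s * ((s + u) / N)) - (1 + \<epsilon>) * (\<epsilon>\<^sup>2 * N / 40)"
    using D N by (simp add: field_simps)
  moreover have "(1 + \<epsilon>) * (s * ((s + u) / N)) \<le> 11/10 * (s * (101/200 * \<epsilon>))"
  proof (rule mult_mono)
    have "(s + u) / N \<le> 101/200 * \<epsilon>"
      using su N(2) by (simp add: pos_divide_le_eq mult.assoc)
    then show "s * ((s + u) / N) \<le> s * (101/200 * \<epsilon>)"
      using s(1) by (rule mult_left_mono)
  qed (use \<epsilon> s(1) u(1) N(2) in simp_all)
  moreover have "(1 + \<epsilon>) * (\<epsilon>\<^sup>2 * N / 40) \<le> 11/10 * (\<epsilon>\<^sup>2 * N / 40)"
    using \<epsilon> N by (intro mult_right_mono) auto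
  moreover have "(1 + \<epsilon>) * s = s + s * \<epsilon>" by (simp add: algebra_simps)
  moreover have "49/100 * (\<epsilon>\<^sup>2 * N) \<le> s * \<epsilon>"
  proof -
    have "49/100 * (\<epsilon> * N) \<le> s" using s eN by linarith
    then have "49/100 * (\<epsilon> * N) * \<epsilon> \<le> s * \<epsilon>"
      using \<epsilon>(1) by (intro mult_right_mono) simp_all
    then show ?thesis by (simp only: power2_eq_square mult.assoc mult.commute mult.left_commute)
  qed
  ultimately show ?thesis using u' N by linarith
qed

lemma prob_long_path_ge:
  fixes \<epsilon> l :: real and n d :: nat
  assumes \<epsilon>: "0 < \<epsilon>" "\<epsilon> < 1/10" and G: "ndl_graph n d l E" and d: "d > 0"
    and l: "l \<le> \<epsilon>\<^sup>2 / 20 * d" and n: "64 \<le> \<epsilon>\<^sup>2 * n"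
  shows "1 - 800 / (\<epsilon> ^ 4 * n) \<le> measure_pmf.prob (random_subgraph E ((1 + \<epsilon>) / d))
    {H. \<exists>xs. is_path n H xs \<and> real (path_length xs) \<ge> 1 / 32 * \<epsilon>\<^sup>2 * n}"
    (is "_ \<le> measure_pmf.prob ?R ?Good")
proof -
  define p where "p = (1 + \<epsilon>) / d"
  \<comment> \<open>Up to lower order the deficit is \<open>\<epsilon> * s - s\<^sup>2 / n\<close>,
    which is largest at \<open>s = \<epsilon> * n / 2\<close>.\<close>
  define s where "s = nat \<lfloor>\<epsilon> * n / 2\<rfloor>"
  define a where "a = \<epsilon>\<^sup>2 * n / 20"
  have reg: "regular_graph n d E" and fin: "finite E"
    using G finite_simple_graph by (auto simp: ndl_graph_def regular_graph_def)
  have n0: "n > 0" using n by (cases n) auto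
  have "card {e \<in> E. 0 \<in> e} = d"
    using reg n0 by (simp add: regular_graph_def degree_of_def)
  then have "{e \<in> E. 0 \<in> e} \<noteq> {}" using d by force
  then have l1: "1 \<le> l"
    using ndl_graph_one_le[OF G] by auto
  have "\<epsilon>\<^sup>2 / 20 \<le> 1 / 2"
    using \<epsilon> power_le_one[of \<epsilon> 2] by simp
  then have "\<epsilon>\<^sup>2 / 20 * d \<le> 1 / 2 * d"
    by (rule mult_right_mono) simp
  then have d2: "real d \<ge> 2" using l l1 by linarith
  have p: "0 \<le> p" "p \<le> 1"
    using \<epsilon> d2 by (auto simp: p_def)
  have "\<epsilon> * n / 2 \<ge> 0" using \<epsilon> by simp
  then have s_eq: "real s = of_int \<lfloor>\<epsilon> * n / 2\<rfloor>"
    by (simp add: s_def)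
  then have s: "real s \<le> \<epsilon> * n / 2" "\<epsilon> * n / 2 - 1 \<le> real s"
    by linarith+
  have "\<epsilon> / 2 * n \<le> 1 * real n" using \<epsilon> by (intro mult_right_mono) auto
  then have "s \<le> n" using s by linarith
  obtain t where t: "queries_within t E"
    and dfs: "\<And>H. H \<subseteq> E \<Longrightarrow> \<exists>S xs. S \<subseteq> {..<n} \<and> card S = s \<and> distinct xs \<and> set xs \<subseteq> {..<n} - S \<and>
      successively (\<lambda>x y. {x, y} \<in> H) xs \<and>
      edges_between E S ({..<n} - S - set xs) \<subseteq> queried t H \<and>
      card (queried t H \<inter> H) \<le> s + length xs"
    using depth_first_search[OF fin \<open>s \<le> n\<close>] by blast
  \<comment> \<open>This step is deterministic: every \<open>H\<close> without a long path has a
    surplus far below zero.\<close>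
  have dichotomy: "H \<in> ?Good \<union> {H. surplus p t H \<le> - a}" if HE: "H \<subseteq> E" for H
  proof (rule ccontr)
    assume H: "H \<notin> ?Good \<union> {H. surplus p t H \<le> - a}"
    obtain S xs where S: "S \<subseteq> {..<n}" "card S = s" and xs: "distinct xs" "set xs \<subseteq> {..<n} - S"
        "successively (\<lambda>x y. {x, y} \<in> H) xs"
      and eb: "edges_between E S ({..<n} - S - set xs) \<subseteq> queried t H"
      and pos: "card (queried t H \<inter> H) \<le> s + length xs"
      using dfs[OF HE] by blast
    let ?T = "{..<n} - S - set xs"
    \<comment> \<open>The added 1 is the gap between the vertices and the edges of a path; an empty
      stack is no path but satisfies the bound trivially.\<close>
    have "real (length xs) \<le> \<epsilon>\<^sup>2 * n / 32 + 1"
    proof (cases "xs = []")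
      case False
      then have "is_path n H xs"
        using xs by (auto simp: is_path_def successively_conv_nth)
      then have "real (path_length xs) < 1 / 32 * \<epsilon>\<^sup>2 * n"
        using H by auto
      then show ?thesis by (simp add: path_length_def)
    qed simp
    moreover have "card ?T = n - s - length xs"
      using S xs distinct_card[OF xs(1)] finite_subset[OF S(1)]
      by (simp add: card_Diff_subset)
    moreover have "s + length xs \<le> n"
    proof -
      have "card (S \<union> set xs) = s + length xs"
        using card_Un_disjoint[of S "set xs"] S(2) xs(2) distinct_card[OF xs(1)]
          finite_subset[OF S(1)] by auto
      moreover have "card (S \<union> set xs) \<le> card {..<n}"
        by (rule card_mono) (use S(1) xs(2) in auto)
      ultimately show ?thesis by simp
    qed
    ultimately have u: "real (length xs) \<le> \<epsilon>\<^sup>2 * n / 32 + 1"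
      and T: "real (card ?T) = real n - s - length xs"
      by auto
    have "real d * s * (real n - s - length xs) / n - l * n / 2 \<le> card (edges_between E S ?T)"
      using expander_mixing_lower_bound[OF G _ S(1), of ?T] l1 T S(2) by auto
    also have "\<dots> \<le> card (queried t H)"
      using card_mono[OF finite_subset[OF queried_subset[OF t] fin] eb] by simp
    finally have "real s + length xs - (1 + \<epsilon>) / d * card (queried t H) \<le> - (\<epsilon>\<^sup>2 * n / 20)"
      using \<epsilon> n n0 s u d l by (intro surplus_deficit_estimate[of _ _ _ _ _ l]) auto
    then have "surplus p t H \<le> - a"
      using pos unfolding surplus_def p_def a_def by linarith
    then show False using H by simp
  qed
  have "1 = measure_pmf.prob ?R (?Good \<union> {H. surplus p t H \<le> - a})"
    using dichotomy set_pmf_random_subgraph[of E "(1 + \<epsilon>) / d"]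
    by (intro measure_pmf.prob_eq_1[THEN iffD2, symmetric]) (auto simp: AE_measure_pmf_iff)
  also have "\<dots> \<le> measure_pmf.prob ?R ?Good + measure_pmf.prob ?R {H. surplus p t H \<le> - a}"
    by (rule measure_Un_le) auto
  also have "measure_pmf.prob ?R {H. surplus p t H \<le> - a} \<le> p * card E / a\<^sup>2"
    using prob_surplus_le[OF fin t p, of a] \<epsilon> n0 by (simp add: a_def p_def)
  also have "p * card E / a\<^sup>2 \<le> 2 * real n / a\<^sup>2"
  proof (rule divide_right_mono)
    have "p * card E \<le> p * (real n * d)"
      using card_edges_le[OF reg] p by (intro mult_left_mono) (simp_all flip: of_nat_mult)
    also have "\<dots> = (1 + \<epsilon>) * n" using d by (simp add: p_def)
    also have "\<dots> \<le> 2 * real n" using \<epsilon> by (intro mult_right_mono) auto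
    finally show "p * card E \<le> 2 * real n" by simp
  qed simp
  \<comment> \<open>The constant is \<open>2 * 20\<^sup>2\<close>, from
    \<open>a = \<epsilon>\<^sup>2 * n / 20\<close>.\<close>
  also have "2 * real n / a\<^sup>2 = 800 / (\<epsilon> ^ 4 * n)"
    using n0 \<epsilon> by (simp add: a_def power2_eq_square power4_eq_xxxx field_simps)
  finally show ?thesis by simp
qed

theorem theorem5:
  shows "\<exists>c::real. c > 0 \<and> (\<exists>\<epsilon>\<^sub>0::real. \<epsilon>\<^sub>0 > 0 \<and>
    (\<forall>\<epsilon>::real. 0 < \<epsilon> \<and> \<epsilon> < \<epsilon>\<^sub>0 \<longrightarrow>
      (\<forall>(n :: nat \<Rightarrow> nat) (d :: nat \<Rightarrow> nat) (l :: nat \<Rightarrow> real) (G :: nat \<Rightarrow> nat set set).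
        filterlim n at_top sequentially \<and>
        (\<forall>k. d k > 0 \<and> ndl_graph (n k) (d k) (l k) (G k)) \<and>
        l \<in> o(\<lambda>k. real (d k)) \<longrightarrow>
        (\<lambda>k. measure_pmf.prob (random_subgraph (G k) ((1 + \<epsilon>) / real (d k)))
               {H. \<exists>xs. is_path (n k) H xs \<and>
                        real (path_length xs) \<ge> c * \<epsilon>\<^sup>2 * real (n k)})
          \<longlonglongrightarrow> 1)))"
proof (rule exI[of _ "1/32"], intro conjI exI[of _ "1/10"] allI impI; (elim conjE)?)
  fix \<epsilon> :: real and n d :: "nat \<Rightarrow> nat" and l :: "nat \<Rightarrow> real" and G :: "nat \<Rightarrow> nat set set"
  assume \<epsilon>: "0 < \<epsilon>" "\<epsilon> < 1/10" and n: "filterlim n at_top sequentially"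
    and G: "\<forall>k. d k > 0 \<and> ndl_graph (n k) (d k) (l k) (G k)"
    and l: "l \<in> o(\<lambda>k. real (d k))"
  let ?P = "\<lambda>k. measure_pmf.prob (random_subgraph (G k) ((1 + \<epsilon>) / real (d k)))
     {H. \<exists>xs. is_path (n k) H xs \<and> real (path_length xs) \<ge> 1 / 32 * \<epsilon>\<^sup>2 * real (n k)}"
  have rn: "filterlim (\<lambda>k. real (n k)) at_top sequentially"
    using filterlim_compose[OF filterlim_real_sequentially n] .
  \<comment> \<open>The hypotheses of the finite bound hold only eventually: the first by
    \<open>l \<in> o(d)\<close> with the constant \<open>\<epsilon>\<^sup>2 / 20\<close>, the second
    because \<open>n\<close> tends to infinity.\<close>
  have "eventually (\<lambda>k. norm (l k) \<le> \<epsilon>\<^sup>2 / 20 * norm (real (d k))) sequentially"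
    using landau_o.smallD[OF l, of "\<epsilon>\<^sup>2 / 20"] \<epsilon> by simp
  moreover have "eventually (\<lambda>k. 64 / \<epsilon>\<^sup>2 \<le> real (n k)) sequentially"
    using rn by (simp add: filterlim_at_top)
  ultimately have lower: "eventually (\<lambda>k. 1 - 800 / (\<epsilon> ^ 4 * real (n k)) \<le> ?P k) sequentially"
  proof eventually_elim
    case (elim k)
    have "l k \<le> \<epsilon>\<^sup>2 / 20 * real (d k)" using elim(1) by simp
    moreover have "64 \<le> \<epsilon>\<^sup>2 * real (n k)"
      using elim(2) \<epsilon>(1) by (simp add: pos_divide_le_eq mult.commute)
    ultimately show ?case
      using prob_long_path_ge[OF \<epsilon>] G by blast
  qed
  have "(\<lambda>k. 800 / \<epsilon> ^ 4 * inverse (real (n k))) \<longlonglongrightarrow> 800 / \<epsilon> ^ 4 * 0"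
    by (intro tendsto_intros tendsto_inverse_0_at_top rn)
  then have "(\<lambda>k. 1 - 800 / \<epsilon> ^ 4 * inverse (real (n k))) \<longlonglongrightarrow> 1 - 800 / \<epsilon> ^ 4 * 0"
    by (intro tendsto_diff tendsto_const)
  then have lim: "(\<lambda>k. 1 - 800 / (\<epsilon> ^ 4 * real (n k))) \<longlonglongrightarrow> 1"
    by (simp add: field_simps)
  show "?P \<longlonglongrightarrow> 1"
    by (rule tendsto_sandwich[OF lower _ lim tendsto_const]) simp
qed simp_all

end
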